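(* Let $\alpha,\beta\in\mathbb{Z}$ be such that the planet dance $\mathcal{P}(\alpha,\beta)$ is in reduced form with $\alpha\neq 0$, and let $a\in\mathbb{Z}$ be any integer. For $m=|\alpha a-\beta|$ (a positive integer) we have $\mathcal{S}_m(\alpha,\beta)=\mathcal{S}_m(1,a)$. Then, for any positive integer $d$, the set of chords $\mathcal{S}_{dm}(1,a)$ consists of $d$ disjoint sets of chords $S_0,\dots,S_{d-1}$. For each $k\in\{0,\dots,d-1\}$, $|S_k|=m$ and $S_k$ is contained in a copy of $\mathcal{P}(\alpha,\beta)$ rotated by $\frac{k}{d(\alpha-\beta)}$ around the circle.
   Context: A directed chord of the unit circle in $\mathbb{C}$ (degenerate chords allowed) with initial point $e^{2\pi i x}$ and terminal point $e^{2\pi i y}$ is identified with the point $(x,y)\in\mathbb{R}^2/\mathbb{Z}^2$. For integers $\alpha,\beta$, the planet dance $\mathcal{P}(\alpha,\beta)$ is the set of directed chords with initial point $e^{2\pi i\alpha t}$ and terminal point $e^{2\pi i\beta t}$, $t\in[0,1]$; that is, $\mathcal{P}(\alpha,\beta)=\{(\alpha t,\beta t): t\in\mathbb{R}\}\subset\mathbb{R}^2/\mathbb{Z}^2$. It is in reduced form if $(\alpha,\beta)\in\{(0,0),(0,1),(1,0)\}$ or $\gcd(\alpha,\beta)=1$. For a positive integer $n$, the $n$-sampling of $\mathcal{P}(\alpha,\beta)$ is the set of chords obtained at $t=0,\frac1n,\dots,\frac{n-1}{n}$: $\mathcal{S}_n(\alpha,\beta)=\{(\frac{\alpha j}{n},\frac{\beta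 j}{n}): 0\le j<n\}\subset\mathbb{R}^2/\mathbb{Z}^2$. Rotation around the circle is measured in full turns: the copy of $\mathcal{P}(\alpha,\beta)$ rotated by $c\in\mathbb{R}$ is the set obtained by multiplying both endpoints of every chord by $e^{2\pi i c}$, i.e. $\{(\alpha t+c,\beta t+c): t\in\mathbb{R}\}\subset\mathbb{R}^2/\mathbb{Z}^2$.
   Formalization: Integers a with αa = β (where m = 0, so m is not positive) are excluded, and containment in the rotated copy is claimed only for α ≠ β, since for α = β the angle k/(d(α−β)) is undefined and the containment fails for d ≥ 2. *)

theory Defs
  imports Complex_Main "HOL-Library.Disjoint_Sets"
begin

definition int_translate :: "real \<times> real \<Rightarrow> real \<times> real \<Rightarrow> bool"
  where "int_translate p q \<longleftrightarrow> fst p - fst q \<in> \<int> \<and> snd p - snd q \<in> \<int>"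

lemma equivp_int_translate: "equivp int_translate"
proof (rule equivpI)
  show "reflp int_translate"
    by (simp add: reflp_def int_translate_def)
  show "symp int_translate"
    unfolding symp_def int_translate_def by (metis Ints_minus minus_diff_eq)
  show "transp int_translate"
    unfolding transp_def int_translate_def
    by (metis Ints_add diff_add_cancel diff_add_eq add_diff_eq)
qed

(* The torus of all directed chords: real pairs modulo integer pairs. *)
quotient_type chord = "real \<times> real" / int_translate
  by (rule equivp_int_translate)

lift_definition Chord :: "real \<Rightarrow> real \<Rightarrow> chord" is "\<lambda>x y. (x, y)" .

lift_definition rotate_chord :: "real \<Rightarrow> chord \<Rightarrow> chord"
  is "\<lambda>c (x, y). (x + c, y + c)"
  by (auto simp: int_translate_def)

lemma Chord_eq_iff: "Chord x y = Chord x' y' \<longleftrightarrow> x - x' \<in> \<int> \<and> y - y' \<in> \<int>"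
  by transfer (simp add: int_translate_def)

lemma rotate_chord_Chord: "rotate_chord c (Chord x y) = Chord (x + c) (y + c)"
  by transfer (simp add: int_translate_def)

(* Equality of chords is equality of their endpoints on the unit circle. *)
lemma cis_2pi_eq_iff: "cis (2 * pi * x) = cis (2 * pi * x') \<longleftrightarrow> x - x' \<in> \<int>"
proof -
  have "cis (2 * pi * x) = cis (2 * pi * x') \<longleftrightarrow> cis (2 * pi * (x - x')) = 1"
    by (simp add: right_diff_distrib flip: cis_divide)
  also have "\<dots> \<longleftrightarrow> cos (2 * pi * (x - x')) = 1"
    by (auto simp: complex_eq_iff intro: cos_one_sin_zero)
  also have "\<dots> \<longleftrightarrow> x - x' \<in> \<int>"
  proof
    assume "cos (2 * pi * (x - x')) = 1"
    then obtain n :: int where "2 * pi * (x - x') = of_int n * 2 * pi"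
      by (auto simp: cos_one_2pi_int)
    then have "x - x' = of_int n" by simp
    then show "x - x' \<in> \<int>" by simp
  next
    assume "x - x' \<in> \<int>"
    then obtain n :: int where "x - x' = of_int n" by (auto elim: Ints_cases)
    then show "cos (2 * pi * (x - x')) = 1"
      by (auto simp: cos_one_2pi_int)
  qed
  finally show ?thesis .
qed

lemma Chord_eq_iff_endpoints:
  "Chord x y = Chord x' y' \<longleftrightarrow>
     cis (2 * pi * x) = cis (2 * pi * x') \<and> cis (2 * pi * y) = cis (2 * pi * y')"
  by (simp add: Chord_eq_iff cis_2pi_eq_iff)

definition planet_dance :: "int \<Rightarrow> int \<Rightarrow> chord set"
  where "planet_dance \<alpha> \<beta> = range (\<lambda>t::real. Chord (of_int \<alpha> * t) (of_int \<beta> * t))"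

(* A property of the parameters: different pairs can give the same set of chords. *)
definition reduced_form :: "int \<Rightarrow> int \<Rightarrow> bool"
  where "reduced_form \<alpha> \<beta> \<longleftrightarrow> (\<alpha>, \<beta>) \<in> {(0, 0), (0, 1), (1, 0)} \<or> gcd \<alpha> \<beta> = 1"

(* Only meaningful for n > 0. *)
definition sampling :: "nat \<Rightarrow> int \<Rightarrow> int \<Rightarrow> chord set"
  where "sampling n \<alpha> \<beta> =
    {Chord (of_int \<alpha> * of_nat j / of_nat n) (of_int \<beta> * of_nat j / of_nat n) | j. j < n}"

end

theory Submission
  imports Defs
begin

text \<open>
  Since \<open>\<alpha>\<close> and \<open>\<beta>\<close> are coprime, a chord \<open>(x, y)\<close> lies on the planet dance iff
  \<open>\<beta> x - \<alpha> y\<close> is an integer. Writing \<open>\<alpha> a - \<beta> = s m\<close> with a sign \<open>s\<close>, the \<open>j\<close>-th chord of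
  the \<open>dm\<close>-sampling of the dance of \<open>(1, a)\<close> has \<open>\<beta> x - \<alpha> y = - s j / d\<close>, and rotating by \<open>c\<close>
  lowers this quantity by \<open>(\<alpha> - \<beta>) c\<close>. The set \<open>S k\<close> therefore collects the chords
  with \<open>j \<equiv> s k\<close> modulo \<open>d\<close>. Both samplings with \<open>m\<close> points agree because
  \<open>\<beta> \<equiv> \<alpha> a\<close> and \<open>\<alpha>\<close> is invertible modulo \<open>m\<close>.
\<close>

lemma range_periodic_int:
  fixes f :: "int \<Rightarrow> 'a"
  assumes "n > 0" and "\<And>i j. n dvd i - j \<Longrightarrow> f i = f j"
  shows "range f = f ` {0..<n}"
proof -
  have "f i \<in> f ` {0..<n}" for i
  proof (rule image_eqI)
    show "f i = f (i mod n)"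
      using assms(2) dvd_minus_mod by blast
    show "i mod n \<in> {0..<n}"
      using assms(1) by simp
  qed
  then show ?thesis
    by blast
qed

lemma card_range_periodic_int:
  fixes f :: "int \<Rightarrow> 'a"
  assumes "n > 0" and eq: "\<And>i j. f i = f j \<longleftrightarrow> n dvd i - j"
  shows "card (range f) = nat n"
proof -
  have "inj_on f {0..<n}"
  proof (rule inj_onI)
    fix i j assume "i \<in> {0..<n}" "j \<in> {0..<n}" "f i = f j"
    then have "i mod n = j mod n"
      using eq mod_eq_dvd_iff by blast
    with \<open>i \<in> _\<close> \<open>j \<in> _\<close> show "i = j"
      by simp
  qed
  then show ?thesis
    using range_periodic_int[of n f] assms by (simp add: card_image)
qed

lemma of_int_divide_in_Ints_iff:
  fixes n z :: int
  assumes "n \<noteq> 0"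
  shows "(of_int z / of_int n :: real) \<in> \<int> \<longleftrightarrow> n dvd z"
proof
  assume "(of_int z / of_int n :: real) \<in> \<int>"
  then obtain k where "(of_int z / of_int n :: real) = of_int k"
    by (elim Ints_cases)
  then have "(of_int z :: real) = of_int (n * k)"
    using assms by (simp add: field_simps)
  then show "n dvd z"
    by (metis dvd_triv_left of_int_eq_iff)
next
  assume "n dvd z"
  then show "(of_int z / of_int n :: real) \<in> \<int>"
    using assms by (auto elim!: dvdE)
qed

lemma Chord_divide_eq_iff:
  fixes n x y x' y' :: int
  assumes "n \<noteq> 0"
  shows "Chord (of_int x / of_int n) (of_int y / of_int n) =
           Chord (of_int x' / of_int n) (of_int y' / of_int n) \<longleftrightarrow>
         n dvd x - x' \<and> n dvd y - y'"
  using of_int_divide_in_Ints_iff[OF assms, of "x - x'"]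
    of_int_divide_in_Ints_iff[OF assms, of "y - y'"]
  by (simp add: Chord_eq_iff diff_divide_distrib)

text \<open>Indexing by all integers allows reindexing, for instance by a multiplier, without
  reducing indices modulo \<open>n\<close>.\<close>

lemma sampling_eq_range:
  assumes "n > 0"
  shows "sampling n \<alpha> \<beta> =
    range (\<lambda>j. Chord (of_int (\<alpha> * j) / of_int (int n)) (of_int (\<beta> * j) / of_int (int n)))"
    (is "_ = range ?f")
proof -
  have "?f i = ?f j" if "int n dvd i - j" for i j
  proof -
    have "int n dvd \<alpha> * i - \<alpha> * j" "int n dvd \<beta> * i - \<beta> * j"
      using that by (simp_all flip: right_diff_distrib)
    then show ?thesis
      using assms by (subst Chord_divide_eq_iff) auto
  qed
  then have "range ?f = ?f ` {0..<int n}"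
    using assms by (intro range_periodic_int) auto
  also have "{0..<int n} = int ` {..<n}"
    by (simp add: image_int_atLeastLessThan flip: atLeast0LessThan)
  also have "?f ` int ` {..<n} = sampling n \<alpha> \<beta>"
    by (auto simp: sampling_def image_image)
  finally show ?thesis ..
qed

text \<open>Modulo \<open>n\<close>, \<beta> j is a (\<alpha> j), so chord \<open>j\<close> on the
  left is chord \<alpha> j on the right. Every index on the right is reached because \<alpha> is a
  unit modulo \<open>n\<close>.\<close>

lemma sampling_cong_multiplier:
  assumes "n > 0" and "coprime \<alpha> (int n)" and cong: "int n dvd \<alpha> * a - \<beta>"
  shows "sampling n \<alpha> \<beta> = sampling n 1 a"
proof -
  let ?C = "\<lambda>x y. Chord (of_int x / of_int (int n)) (of_int y / of_int (int n))"
  obtain p q where pq: "p * \<alpha> + q * int n = 1"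
    using assms(2) bezout_int[of \<alpha> "int n"] by auto
  have *: "?C (\<alpha> * j) (\<beta> * j) = ?C i (a * i)" if "int n dvd \<alpha> * j - i" for i j
  proof -
    have "\<beta> * j - a * i = a * (\<alpha> * j - i) - (\<alpha> * a - \<beta>) * j"
      by (simp add: algebra_simps)
    also have "int n dvd \<dots>"
      by (intro dvd_diff dvd_mult dvd_mult2 that cong)
    finally show ?thesis
      using that assms(1) by (subst Chord_divide_eq_iff) auto
  qed
  have "range (\<lambda>j. ?C (\<alpha> * j) (\<beta> * j)) = range (\<lambda>i. ?C (1 * i) (a * i))"
  proof (intro equalityI image_subsetI)
    fix j
    show "?C (\<alpha> * j) (\<beta> * j) \<in> range (\<lambda>i. ?C (1 * i) (a * i))"
      using *[of j "\<alpha> * j"] by (intro image_eqI[of _ _ "\<alpha> * j"]) auto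
  next
    fix i
    \<comment> \<open>\<open>p\<close> inverts \<alpha> modulo \<open>n\<close>, so
      \<open>p * i\<close> is the index on the left that matches \<open>i\<close>.\<close>
    have "\<alpha> * (p * i) - i = i * (p * \<alpha> - 1)"
      by (simp add: algebra_simps)
    also have "\<dots> = int n * (- (i * q))"
      using pq by (simp add: algebra_simps flip: pq)
    finally have "int n dvd \<alpha> * (p * i) - i"
      by simp
    from *[OF this] show "?C (1 * i) (a * i) \<in> range (\<lambda>j. ?C (\<alpha> * j) (\<beta> * j))"
      by (metis (no_types, lifting) mult_1 rangeI)
  qed
  then show ?thesis
    unfolding sampling_eq_range[OF assms(1)] .
qed

lemma Chord_in_planet_danceI:
  assumes "coprime \<alpha> \<beta>" and "\<alpha> \<noteq> 0"
    and "of_int \<beta> * x - of_int \<alpha> * y \<in> \<int>"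
  shows "Chord x y \<in> planet_dance \<alpha> \<beta>"
proof -
  obtain n where n: "of_int \<beta> * x - of_int \<alpha> * y = of_int n"
    using assms(3) by (elim Ints_cases)
  obtain p q where pq: "p * \<alpha> + q * \<beta> = 1"
    using assms(1) bezout_int[of \<alpha> \<beta>] by auto
  \<comment> \<open>The Bezout identity makes \<open>(x - n * q, y + n * p)\<close> a representative
    of the same chord lying on the real line through the origin with direction (\<alpha>, \<beta>);
    \<open>t\<close> is its parameter.\<close>
  define t where "t = (x - of_int (n * q)) / of_int \<alpha>"
  have t: "of_int \<alpha> * t = x - of_int (n * q)"
    using assms(2) by (simp add: t_def)
  have "of_int \<alpha> * (of_int \<beta> * t) = of_int \<beta> * (of_int \<alpha> * t)"
    by simp
  also have "\<dots> = of_int (n * (p * \<alpha> + q * \<beta>)) + of_int \<alpha> * y - of_int \<beta> * of_int (n * q)"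
    unfolding t pq using n by (simp add: algebra_simps)
  also have "\<dots> = of_int \<alpha> * (y + of_int (n * p))"
    by (simp add: algebra_simps)
  finally have "of_int \<beta> * t = y + of_int (n * p)"
    using assms(2) by simp
  with t have "Chord x y = Chord (of_int \<alpha> * t) (of_int \<beta> * t)"
    by (simp add: Chord_eq_iff)
  then show ?thesis
    by (simp add: planet_dance_def)
qed

lemma Chord_in_rotate_planet_danceI:
  assumes "coprime \<alpha> \<beta>" and "\<alpha> \<noteq> 0"
    and "of_int \<beta> * x - of_int \<alpha> * y + of_int (\<alpha> - \<beta>) * c \<in> \<int>"
  shows "Chord x y \<in> rotate_chord c ` planet_dance \<alpha> \<beta>"
proof (rule image_eqI)
  show "Chord x y = rotate_chord c (Chord (x - c) (y - c))"
    by (simp add: rotate_chord_Chord)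
  show "Chord (x - c) (y - c) \<in> planet_dance \<alpha> \<beta>"
    using assms by (intro Chord_in_planet_danceI) (simp_all add: algebra_simps)
qed

text \<open>As \<open>s\<close> is its own inverse, \<open>k\<close> can be taken as the residue of
  \<open>s * j\<close> modulo \<open>d\<close>.\<close>

lemma ex_residue_signed:
  fixes s j :: int
  assumes "d > 0" and "s * s = 1"
  shows "\<exists>k<d. \<exists>i. j = s * int k + int d * i"
proof (intro exI conjI)
  show "nat (s * j mod int d) < d"
    using assms(1) by (simp add: nat_less_iff)
  have "j = s * (s * j)"
    using assms(2) by (simp flip: mult.assoc)
  also have "\<dots> = s * (s * j mod int d + int d * (s * j div int d))"
    by simp
  also have "\<dots> = s * int (nat (s * j mod int d)) + int d * (s * (s * j div int d))"
    using assms(1) by (simp only: distrib_left mult.left_commute) simp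
  finally show "j = s * int (nat (s * j mod int d)) + int d * (s * (s * j div int d))" .
qed

theorem theorem4p2:
  fixes \<alpha> \<beta> a :: int and m :: nat
  assumes "reduced_form \<alpha> \<beta>"
    and "\<alpha> \<noteq> 0"
    and "m = nat \<bar>\<alpha> * a - \<beta>\<bar>"
    and "m > 0"
  shows "sampling m \<alpha> \<beta> = sampling m 1 a \<and>
    (\<forall>d::nat. d > 0 \<longrightarrow>
      (\<exists>S :: nat \<Rightarrow> chord set.
        sampling (d * m) 1 a = (\<Union>k<d. S k) \<and>
        disjoint_family_on S {..<d} \<and>
        (\<forall>k<d. card (S k) = m \<and>
          (\<alpha> \<noteq> \<beta> \<longrightarrow>
            S k \<subseteq> rotate_chord (real k / (real d * real_of_int (\<alpha> - \<beta>))) ` planet_dance \<alpha> \<beta>))))"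
proof (intro conjI allI impI)
  \<comment> \<open>Among the exceptional pairs only (1, 0) has a nonzero first entry, and its gcd
    is 1.\<close>
  have coprime: "coprime \<alpha> \<beta>"
    using assms(1,2) by (auto simp: reduced_form_def coprime_iff_gcd_eq_1)
  define s where "s = sgn (\<alpha> * a - \<beta>)"
  have s: "s * s = 1" and sm: "\<alpha> * a - \<beta> = s * int m"
    using assms(3,4) by (auto simp: s_def sgn_if)
  have "coprime \<alpha> (int m)"
  proof (rule coprimeI)
    fix c assume "c dvd \<alpha>" "c dvd int m"
    moreover have "\<beta> = a * \<alpha> - s * int m"
      using sm by (simp add: algebra_simps)
    ultimately have "c dvd \<beta>"
      by simp
    with coprime \<open>c dvd \<alpha>\<close> show "is_unit c"
      by (rule coprime_common_divisor)
  qed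
  then show "sampling m \<alpha> \<beta> = sampling m 1 a"
    using assms(4) sm by (intro sampling_cong_multiplier) auto
  fix d :: nat assume d: "d > 0"
  define N where "N = int (d * m)"
  have N: "N > 0"
    using d assms(4) by (simp add: N_def)
  define Q where "Q j = Chord (of_int j / of_int N) (of_int (a * j) / of_int N)" for j
  \<comment> \<open>\<open>Q\<close> has exact period \<open>N\<close>, that is
    \<open>d * m\<close>, so \<open>i\<close> matters only modulo \<open>m\<close>; this yields the
    cardinality. The factor \<open>s\<close> cancels the sign of \<alpha> a - \<beta>, so that the
    rotation angle comes out as a positive multiple of 1 / (d (\<alpha> - \<beta>)).\<close>
  define S where "S k = range (\<lambda>i. Q (s * int k + int d * i))" for k
  have Q_eq: "Q i = Q j \<longleftrightarrow> N dvd i - j" for i j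
    using N unfolding Q_def
    by (subst Chord_divide_eq_iff) (auto simp flip: right_diff_distrib)
  have card: "card (S k) = m" for k
  proof -
    have "card (S k) = nat (int m)"
      unfolding S_def
    proof (rule card_range_periodic_int)
      show "Q (s * int k + int d * i) = Q (s * int k + int d * j) \<longleftrightarrow> int m dvd i - j" for i j
        using d by (simp add: Q_eq N_def flip: right_diff_distrib)
    qed (use assms(4) in simp)
    then show ?thesis
      by simp
  qed
  have "sampling (d * m) 1 a = range Q"
    using d assms(4) by (simp add: sampling_eq_range Q_def[abs_def] N_def)
  also have "\<dots> = (\<Union>k<d. S k)"
  proof (intro equalityI image_subsetI)
    fix j
    obtain k i where "k < d" "j = s * int k + int d * i"
      using ex_residue_signed[OF d s] by blast
    then show "Q j \<in> (\<Union>k<d. S k)"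
      by (auto simp: S_def)
  qed (auto simp: S_def)
  finally have union: "sampling (d * m) 1 a = (\<Union>k<d. S k)" .
  have disjoint: "disjoint_family_on S {..<d}"
    unfolding disjoint_family_on_def
  proof (intro ballI impI, rule ccontr)
    fix k l assume kl: "k \<in> {..<d}" "l \<in> {..<d}" "k \<noteq> l" "S k \<inter> S l \<noteq> {}"
    then obtain i j where "Q (s * int k + int d * i) = Q (s * int l + int d * j)"
      by (auto simp: S_def)
    then have "N dvd (s * int k + int d * i) - (s * int l + int d * j)"
      by (simp add: Q_eq)
    then have "int d dvd (s * int k + int d * i) - (s * int l + int d * j)"
      by (rule dvd_trans[rotated]) (simp add: N_def)
    \<comment> \<open>Multiplying by \<open>s\<close> and removing the multiple of \<open>d\<close>
      that contains \<open>i\<close> and \<open>j\<close> isolates \<open>k - l\<close>; both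
      indices are below \<open>d\<close>, so the congruence forces equality.\<close>
    then have "int d dvd s * ((s * int k + int d * i) - (s * int l + int d * j)) - int d * (s * (i - j))"
      by (rule dvd_diff[OF dvd_mult dvd_triv_left])
    also have "\<dots> = (s * s) * (int k - int l)"
      by (simp add: algebra_simps)
    finally have "int k mod int d = int l mod int d"
      by (simp add: s mod_eq_dvd_iff)
    with kl show False
      by simp
  qed
  have subset: "S k \<subseteq> rotate_chord (real k / (real d * real_of_int (\<alpha> - \<beta>))) ` planet_dance \<alpha> \<beta>"
    if "\<alpha> \<noteq> \<beta>" for k
    unfolding S_def Q_def
  proof (intro image_subsetI Chord_in_rotate_planet_danceI coprime assms(2))
    fix i
    let ?j = "s * int k + int d * i"
    \<comment> \<open>Here \<alpha> \<noteq> \<beta> is essential: otherwise the denominator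
      vanishes and division by zero would make the angle 0.\<close>
    have rot: "of_int (\<alpha> - \<beta>) * (real k / (real d * real_of_int (\<alpha> - \<beta>))) = real k / real d"
      using that by simp
    have "of_int \<beta> * (of_int ?j / of_int N) - of_int \<alpha> * (of_int (a * ?j) / of_int N)
        = - (of_int (\<alpha> * a - \<beta>) * of_int ?j / of_int N :: real)"
      by (simp add: field_simps diff_divide_distrib add_divide_distrib)
    \<comment> \<open>The factor \<open>m\<close> of \<alpha> a - \<beta> cancels against the one in
      \<open>N\<close>, leaving the denominator \<open>d\<close>.\<close>
    also have "\<dots> = - (of_int (s * ?j) / real d)"
      unfolding sm using assms(4) d by (simp add: N_def)
    also have "s * ?j = (s * s) * int k + int d * (s * i)"
      by (simp add: algebra_simps)
    also have "\<dots> = int k + int d * (s * i)"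
      by (simp add: s)
    also have "- (of_int \<dots> / real d) = - (real k / real d) - of_int (s * i)"
      using d by (simp add: field_simps)
    finally show "of_int \<beta> * (of_int ?j / of_int N) - of_int \<alpha> * (of_int (a * ?j) / of_int N)
        + of_int (\<alpha> - \<beta>) * (real k / (real d * real_of_int (\<alpha> - \<beta>))) \<in> \<int>"
      unfolding rot by simp
  qed
  show "\<exists>S :: nat \<Rightarrow> chord set.
        sampling (d * m) 1 a = (\<Union>k<d. S k) \<and>
        disjoint_family_on S {..<d} \<and>
        (\<forall>k<d. card (S k) = m \<and>
          (\<alpha> \<noteq> \<beta> \<longrightarrow>
            S k \<subseteq> rotate_chord (real k / (real d * real_of_int (\<alpha> - \<beta>))) ` planet_dance \<alpha> \<beta>))"
    using union disjoint card subset by blast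
qed

end
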